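(* Let $n\ge 3$ be an integer. Let $q$ be a positive integer and $w_{\max},a_{\max}\in(0,\infty)$ be constants. Consider a growing network described by undirected weighted graphs $\mathcal{G}=\mathcal{G}_N$ with $N$ nodes, one for each network size $N$ in an infinite set of positive integers (each $N\ge 2$). Suppose that in each graph there is a path from node $1$ (the leader) to every other node, and that: (1) $|\mathcal{N}_i|\le q$ for every node $i$; (2) $w_{ij}\le w_{\max}$ for every edge $(i,j)$; where $q$ and $w_{\max}$ do not depend on $N$. Let $a_0,\dots,a_{n-1}\in[0,a_{\max}]$ be fixed gains independent of $N$. Then the leader-follower consensus algorithm, whose closed-loop dynamics are $$\frac{d}{dt}\bar\xi=\begin{bmatrix}0&I_{N-1}&0&\cdots&0\\0&0&I_{N-1}&\cdots&0\\ \vdots&&&\ddots&\vdots\\0&0&0&\cdots&I_{N-1}\\-a_0\bar L&-a_1\bar L&-a_2\bar L&\cdots&-a_{n-1}\bar L\end{bmatrix}\bar\xi,$$ where $\bar L$ is the grounded Laplacian of $\mathcal{G}_N$, is inadmissible. That is, there is a finite network size $N$ for which the closed-loop system does not reach consensus.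
   Context: Graphs: $\mathcal{G}=\{\mathcal{V},\mathcal{E}\}$ has $N=|\mathcal{V}|$ nodes and edge set $\mathcal{E}\subset\mathcal{V}\times\mathcal{V}$ (no self-loops). Each edge $(i,j)$ has a nonnegative weight $w_{ij}$, and $w_{ij}=0$ if $(i,j)\notin\mathcal{E}$. The graph is undirected if $(i,j)\in\mathcal{E}$ implies $(j,i)\in\mathcal{E}$, and $w_{ij}=w_{ji}$. The neighbor set is $\mathcal{N}_i=\{j:(i,j)\in\mathcal{E}\}$. Laplacian: $[L]_{ij}=-w_{ij}$ if $j\ne i$ and $j\in\mathcal{N}_i$, $[L]_{ii}=\sum_{k\in\mathcal{N}_i}w_{ik}$, and $[L]_{ij}=0$ otherwise. The grounded Laplacian $\bar L$ is the $(N-1)\times(N-1)$ matrix obtained from $L$ by deleting its first row and column. Dynamics: each node $i$ has a scalar state $x_i(t)\in\mathbb{R}$ with $k$-th time derivative $x_i^{(k)}$. The leader, agent $1$, has its state fixed, with $x_1^{(k)}\equiv 0$ for $k=0,\dots,n$. Each other agent $i\in\{2,\dots,N\}$ is a chain of $n$ integrators, $x_i^{(n)}=u_i$, with control $u_i=-\sum_{k=0}^{n-1}a_k\sum_{j\in\mathcal{N}_i}w_{ij}(x_i^{(k)}-x_j^{(k)})$. The vector $\bar\xi$ stacks $\bar x^{(0)},\bar x^{(1)},\dots,\bar x^{(n-1)}$, where $\bar x^{(k)}=(x_2^{(k)},\dots,x_N^{(k)})^T$. Consensus is reached if, for every initial condition, $x_i^{(k)}(t)-x_j^{(k)}(t)\to0$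 as $t\to\infty$ for all nodes $i,j$ (including the leader) and all $k=0,\dots,n-1$. Admissibility: a control design is admissible only if the resulting closed-loop system reaches consensus for any finite network size $N$ (in the growing network under consideration); otherwise it is inadmissible. An increase in the network size means the addition of nodes together with connecting edges in such a manner that the assumptions in the claim remain satisfied, with the gains, $q$ and $w_{\max}$ unchanged. *)

theory Defs
  imports
    Complex_Main
    "Graph_Theory.Pair_Digraph"
    "Jordan_Normal_Form.Determinant"
begin

text \<open>Nodes are \<open>1, \<dots>, N\<close>, and node \<open>1\<close> is the leader.  A \<open>pair_graph\<close> is finite, loop-free and
  symmetric, its arcs being ordered pairs of nodes.\<close>

definition undirected_weighted_graph ::
    "nat \<Rightarrow> nat pair_pre_digraph \<Rightarrow> (nat \<Rightarrow> nat \<Rightarrow> real) \<Rightarrow> bool" where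
  "undirected_weighted_graph N G w \<longleftrightarrow>
     pair_graph G \<and> pverts G = {1..N} \<and>
     (\<forall>(i, j) \<in> parcs G. 0 \<le> w i j) \<and>
     (\<forall>i \<in> {1..N}. \<forall>j \<in> {1..N}. (i, j) \<notin> parcs G \<longrightarrow> w i j = 0) \<and>
     (\<forall>i \<in> {1..N}. \<forall>j \<in> {1..N}. w i j = w j i)"

definition neighbors :: "nat pair_pre_digraph \<Rightarrow> nat \<Rightarrow> nat set" where
  "neighbors G i = {j. (i, j) \<in> parcs G}"

text \<open>Matrix indices start at \<open>0\<close>: row and column \<open>r\<close> belong to node \<open>r + 1\<close>.\<close>

definition laplacian ::
    "nat \<Rightarrow> nat pair_pre_digraph \<Rightarrow> (nat \<Rightarrow> nat \<Rightarrow> real) \<Rightarrow> real mat" where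
  "laplacian N G w = mat N N (\<lambda>(r, c).
     let i = r + 1; j = c + 1 in
     if i = j then (\<Sum>k \<in> neighbors G i. w i k)
     else if j \<in> neighbors G i then - w i j
     else 0)"

definition grounded_laplacian ::
    "nat \<Rightarrow> nat pair_pre_digraph \<Rightarrow> (nat \<Rightarrow> nat \<Rightarrow> real) \<Rightarrow> real mat" where
  "grounded_laplacian N G w = mat_delete (laplacian N G w) 0 0"

text \<open>The block companion matrix with \<open>n \<times> n\<close> blocks of size \<open>m \<times> m\<close>, where \<open>m\<close> is the dimension
  of \<open>L\<close>.  Entry \<open>(r, c)\<close> lies in block \<open>(r div m, c div m)\<close>, at position \<open>(r mod m, c mod m)\<close>.\<close>

definition closed_loop_matrix :: "nat \<Rightarrow> (nat \<Rightarrow> real) \<Rightarrow> real mat \<Rightarrow> real mat" where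
  "closed_loop_matrix n a L =
     (let m = dim_row L in
      mat (n * m) (n * m) (\<lambda>(r, c).
        if r div m = n - 1 then - a (c div m) * L $$ (r mod m, c mod m)
        else if c div m = r div m + 1 then 1\<^sub>m m $$ (r mod m, c mod m)
        else 0))"

definition solves_linear_ode :: "real mat \<Rightarrow> (real \<Rightarrow> real vec) \<Rightarrow> bool" where
  "solves_linear_ode A \<xi> \<longleftrightarrow>
     (\<forall>t \<ge> 0. \<xi> t \<in> carrier_vec (dim_row A) \<and>
        (\<forall>r < dim_row A.
           ((\<lambda>s. \<xi> s $ r) has_real_derivative (A *\<^sub>v \<xi> t) $ r) (at t within {0..})))"

text \<open>The \<open>k\<close>-th derivative of the state of node \<open>i\<close> at time \<open>t\<close>, read off from the stacked vector
  \<open>\<xi>\<close>, in which the block of \<open>k\<close>-th derivatives has the \<open>N - 1\<close> entries of the nodes \<open>2, \<dots>, N\<close>.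
  The leader's state is identically zero.\<close>

definition node_state :: "nat \<Rightarrow> (real \<Rightarrow> real vec) \<Rightarrow> nat \<Rightarrow> nat \<Rightarrow> real \<Rightarrow> real" where
  "node_state N \<xi> i k t = (if i = 1 then 0 else \<xi> t $ (k * (N - 1) + (i - 2)))"

definition reaches_consensus ::
    "nat \<Rightarrow> (nat \<Rightarrow> real) \<Rightarrow> nat \<Rightarrow> nat pair_pre_digraph \<Rightarrow> (nat \<Rightarrow> nat \<Rightarrow> real) \<Rightarrow> bool" where
  "reaches_consensus n a N G w \<longleftrightarrow>
     (\<forall>\<xi>\<^sub>0 \<in> carrier_vec (n * (N - 1)). \<forall>\<xi>.
        solves_linear_ode (closed_loop_matrix n a (grounded_laplacian N G w)) \<xi> \<and> \<xi> 0 = \<xi>\<^sub>0 \<longrightarrow>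
        (\<forall>i \<in> {1..N}. \<forall>j \<in> {1..N}. \<forall>k < n.
           ((\<lambda>t. node_state N \<xi> i k t - node_state N \<xi> j k t) \<longlongrightarrow> 0) at_top))"

definition admissible ::
    "nat \<Rightarrow> (nat \<Rightarrow> real) \<Rightarrow> nat set \<Rightarrow> (nat \<Rightarrow> nat pair_pre_digraph) \<Rightarrow>
      (nat \<Rightarrow> nat \<Rightarrow> nat \<Rightarrow> real) \<Rightarrow> bool" where
  "admissible n a S G w \<longleftrightarrow> (\<forall>N \<in> S. reaches_consensus n a N (G N) (w N))"

end

theory Submission
  imports
    Defs
    "HOL-Computational_Algebra.Fundamental_Theorem_Algebra"
    "HOL-Analysis.Function_Topology"
begin

text \<open>
  An eigenvector \<open>v\<close> of the grounded Laplacian with eigenvalue \<open>\<mu>\<close> decouples the closed loop: if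
  \<open>s\<close> is a root of the modal polynomial \<open>s\<^sup>n + \<mu> (a\<^sub>0 + a\<^sub>1 s + \<dots> + a\<^bsub>n-1\<^esub> s\<^bsup>n-1\<^esup>)\<close>, then the states
  \<open>Re (s\<^sup>k e\<^bsup>st\<^esup>) v\<^sub>i\<close> solve the dynamics (\<open>closed_loop_modal_solution\<close>), and they do not tend to the
  leader's state \<open>0\<close> as soon as \<open>Re s \<ge> 0\<close> (\<open>unstable_mode_no_consensus\<close>).  So it suffices to find
  one eigenvalue whose modal polynomial has a root outside the open left half-plane.

  Large networks have small eigenvalues.  The row of node \<open>i\<close> in the grounded Laplacian sums to
  \<open>w\<^sub>i\<^sub>1\<close>, so the quadratic form at the all-ones vector is the total weight of the leader's edges, at
  most \<open>q w_max\<close>; the least eigenvalue, being the minimum of the Rayleigh quotient, is therefore at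
  most \<open>q w_max / (N - 1)\<close>.

  Small eigenvalues are unstable when \<open>n \<ge> 3\<close> (\<open>small_gain_unstable_root\<close>).  If all roots
  \<open>z\<^sub>1, \<dots>, z\<^sub>n\<close> of a monic real polynomial with coefficients \<open>b\<^sub>k\<close> have \<open>Re z\<^sub>i \<le> 0\<close>, then Vieta's formulas
  for \<open>\<Sum> z\<^sub>i\<close> and \<open>\<Sum> z\<^sub>i\<^sup>2\<close> bound \<open>\<Sum> \<bar>z\<^sub>i\<bar>\<^sup>2\<close> by \<open>b\<^bsub>n-1\<^esub>\<^sup>2 + 2 b\<^bsub>n-2\<^esub>\<close>.  Here that is \<open>O(\<mu>)\<close>,
  whereas \<open>\<Prod> \<bar>z\<^sub>i\<bar>\<^sup>2 = \<mu>\<^sup>2 a\<^sub>0\<^sup>2\<close>; thus \<open>\<mu>\<^sup>2 a\<^sub>0\<^sup>2 = O(\<mu>\<^sup>n)\<close>, which fails for small \<open>\<mu> > 0\<close> if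
  \<open>a\<^sub>0 > 0\<close>.  If \<open>a\<^sub>0 = 0\<close>, then \<open>s = 0\<close> is a root, and for \<open>\<mu> \<le> 0\<close> there is a real root in \<open>[0, \<infinity>)\<close>.
\<close>

section \<open>Roots of the modal polynomial\<close>

text \<open>Vieta's formulas for the first two power sums of \<open>z\<^sub>0, \<dots>, z\<^bsub>n-1\<^esub>\<close>, stated for the reflected
  product so that the coefficients have indices independent of \<open>n\<close>.\<close>

lemma vieta_prod_reflected:
  fixes z :: "nat \<Rightarrow> complex"
  defines "P \<equiv> \<lambda>n. \<Prod>i<n. [:1, - z i:]"
  shows "coeff (P n) 0 = 1"
    and "coeff (P n) 1 = - (\<Sum>i<n. z i)"
    and "2 * coeff (P n) 2 = (\<Sum>i<n. z i)\<^sup>2 - (\<Sum>i<n. (z i)\<^sup>2)"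
proof -
  have P_Suc: "P (Suc n) = P n - smult (z n) (pCons 0 (P n))" for n
    by (simp add: P_def mult.commute)
  have c0: "coeff (P n) 0 = 1" for n
    by (induction n) (simp_all add: P_Suc, simp add: P_def)
  have c1: "coeff (P n) 1 = - (\<Sum>i<n. z i)" for n
  proof (induction n)
    case 0
    then show ?case by (simp add: P_def)
  next
    case (Suc n)
    then show ?case using c0[of n] by (simp add: P_Suc)
  qed
  have c2: "2 * coeff (P n) 2 = (\<Sum>i<n. z i)\<^sup>2 - (\<Sum>i<n. (z i)\<^sup>2)" for n
  proof (induction n)
    case 0
    then show ?case by (simp add: P_def)
  next
    case (Suc n)
    have "2 * coeff (P (Suc n)) 2 = 2 * coeff (P n) 2 - 2 * z n * coeff (P n) 1"
      by (simp add: P_Suc numeral_2_eq_2 algebra_simps)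
    then show ?case
      by (simp only: Suc.IH c1) (simp add: power2_eq_square algebra_simps)
  qed
  show "coeff (P n) 0 = 1" "coeff (P n) 1 = - (\<Sum>i<n. z i)"
    "2 * coeff (P n) 2 = (\<Sum>i<n. z i)\<^sup>2 - (\<Sum>i<n. (z i)\<^sup>2)"
    by (fact c0 c1 c2)+
qed

lemma sum_squares_le_square_sum:
  fixes f :: "'a \<Rightarrow> real"
  assumes "finite A" "\<And>i. i \<in> A \<Longrightarrow> 0 \<le> f i"
  shows "(\<Sum>i\<in>A. (f i)\<^sup>2) \<le> (\<Sum>i\<in>A. f i)\<^sup>2"
  using assms
proof (induction A rule: finite_induct)
  case (insert x A)
  have "0 \<le> f x * sum f A"
    using insert.prems by (intro mult_nonneg_nonneg sum_nonneg) auto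
  then show ?case
    using insert by (simp add: power2_sum)
qed simp

text \<open>A quantitative form of the fact that in a stable polynomial the constant coefficient cannot be
  large compared with the subleading ones: the base of the power on the right
  bounds \<open>\<bar>z\<bar>\<^sup>2\<close> for every root \<open>z\<close>.\<close>

lemma closed_left_half_plane_poly_coeff_bound:
  fixes p :: "real poly"
  assumes monic: "lead_coeff p = 1" and deg: "degree p = n" "n \<ge> 2"
    and roots: "\<And>z. poly (map_poly complex_of_real p) z = 0 \<Longrightarrow> Re z \<le> 0"
  shows "(coeff p 0)\<^sup>2 \<le> ((coeff p (n - 1))\<^sup>2 + 2 * coeff p (n - 2)) ^ n"
proof -
  define P where "P = map_poly complex_of_real p"
  have P_coeff: "coeff P k = complex_of_real (coeff p k)" for k
    by (simp add: P_def coeff_map_poly)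
  have P_deg: "degree P = n"
    using deg by (simp add: P_def degree_map_poly)
  obtain z where "smult (lead_coeff P) (\<Prod>i<degree P. [:- z i, 1:]) = P"
    by (rule complex_poly_decompose')
  then have P_eq: "P = (\<Prod>i<n. [:- z i, 1:])"
    using monic deg by (simp add: P_coeff P_deg)
  have z_root: "poly P (z i) = 0" if "i < n" for i
    unfolding P_eq poly_prod using that by (intro prod_zero) auto
  have Re_z: "Re (z i) \<le> 0" if "i < n" for i
    using roots z_root[OF that] by (simp add: P_def)
  have reflected: "reflect_poly P = (\<Prod>i<n. [:1, - z i:])"
    by (simp add: P_eq reflect_poly_prod reflect_poly_pCons' monom_altdef)
  have b1: "complex_of_real (coeff p (n - 1)) = - (\<Sum>i<n. z i)"
    using vieta_prod_reflected(2)[of z n] deg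
    by (simp flip: reflected add: coeff_reflect_poly P_deg P_coeff)
  have b2: "2 * complex_of_real (coeff p (n - 2)) = (\<Sum>i<n. z i)\<^sup>2 - (\<Sum>i<n. (z i)\<^sup>2)"
    using vieta_prod_reflected(3)[of z n] deg
    by (simp flip: reflected add: coeff_reflect_poly P_deg P_coeff)
  define B where "B = (coeff p (n - 1))\<^sup>2 + 2 * coeff p (n - 2)"
  have sum_Re: "(\<Sum>i<n. Re (z i)) = - coeff p (n - 1)"
    using arg_cong[OF b1, of Re] by simp
  have "(\<Sum>i<n. (z i)\<^sup>2) = complex_of_real ((coeff p (n - 1))\<^sup>2 - 2 * coeff p (n - 2))"
    using b1 b2 by (simp add: algebra_simps)
  then have sum_Re_squares: "(\<Sum>i<n. Re ((z i)\<^sup>2)) = (coeff p (n - 1))\<^sup>2 - 2 * coeff p (n - 2)"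
    by (simp only: Re_complex_of_real flip: Re_sum)
  have "(\<Sum>i<n. (Re (z i))\<^sup>2) \<le> (coeff p (n - 1))\<^sup>2"
    using sum_squares_le_square_sum[of "{..<n}" "\<lambda>i. - Re (z i)"] Re_z sum_Re
    by (simp add: sum_negf)
  \<comment> \<open>only \<open>Re (z\<^sup>2)\<close> is visible in the coefficients; the sign condition on \<open>Re z\<close> has made
    \<open>\<Sum> (Re z)\<^sup>2\<close> controllable as well\<close>
  moreover have "(cmod (z i))\<^sup>2 = 2 * (Re (z i))\<^sup>2 - Re ((z i)\<^sup>2)" for i
    by (simp add: cmod_power2 Re_power2)
  ultimately have sum_B: "(\<Sum>i<n. (cmod (z i))\<^sup>2) \<le> B"
    by (simp add: sum_subtractf sum_Re_squares B_def flip: sum_distrib_left)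
  have z_le: "(cmod (z i))\<^sup>2 \<le> B" if "i < n" for i
    using member_le_sum[of i "{..<n}" "\<lambda>i. (cmod (z i))\<^sup>2"] that sum_B by simp
  have "coeff P 0 = (\<Prod>i<n. - z i)"
    by (simp add: P_eq poly_prod flip: poly_0_coeff_0)
  then have "complex_of_real (coeff p 0) = (\<Prod>i<n. - z i)"
    by (simp add: P_coeff)
  then have "cmod (complex_of_real (coeff p 0)) = (\<Prod>i<n. cmod (- z i))"
    by (simp only: prod_norm)
  then have "\<bar>coeff p 0\<bar> = (\<Prod>i<n. cmod (z i))"
    by simp
  then have "(coeff p 0)\<^sup>2 = (\<Prod>i<n. (cmod (z i))\<^sup>2)"
    by (metis power2_abs prod_power_distrib)
  also have "\<dots> \<le> (\<Prod>i<n. B)"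
    using z_le by (intro prod_mono) auto
  finally show ?thesis by (simp add: B_def)
qed

text \<open>No lower bound on \<open>\<mu>\<close> is needed: for \<open>\<mu> \<le> 0\<close> the polynomial is nonpositive at \<open>0\<close> and has a
  real root in \<open>[0, \<infinity>)\<close>.  This makes it unnecessary to know that the grounded Laplacian is positive
  semidefinite.\<close>

lemma small_gain_unstable_root:
  fixes a :: "nat \<Rightarrow> real"
  assumes n: "n \<ge> 3" and a: "\<And>k. k < n \<Longrightarrow> 0 \<le> a k"
  obtains \<delta> :: real where "\<delta> > 0"
    "\<And>\<mu>. \<mu> < \<delta> \<Longrightarrow> \<exists>s::complex. 0 \<le> Re s \<and> s ^ n + of_real \<mu> * (\<Sum>k<n. of_real (a k) * s ^ k) = 0"
proof (cases "a 0 = 0")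
  case True
  have "(\<Sum>k<n. complex_of_real (a k) * 0 ^ k) = 0"
    using True by (intro sum.neutral) (auto simp: power_0_left)
  then have "\<exists>s::complex. 0 \<le> Re s \<and> s ^ n + of_real \<mu> * (\<Sum>k<n. of_real (a k) * s ^ k) = 0" for \<mu>
    using n by (intro exI[of _ 0]) simp
  then show ?thesis using that[of 1] by simp
next
  case False
  then have a0: "a 0 > 0" using a[of 0] n by simp
  \<comment> \<open>for \<open>0 < \<mu> \<le> 1\<close> roots all in the closed left half-plane would satisfy \<open>\<bar>z\<bar>\<^sup>2 \<le> \<mu> C\<close>\<close>
  define C where "C = (a (n - 1))\<^sup>2 + 2 * a (n - 2) + 1"
  have C: "C \<ge> 1" using a[of "n - 2"] n by (simp add: C_def)
  define \<delta> where "\<delta> = min (1 / C) ((a 0)\<^sup>2 / C ^ 3)"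
  have "\<delta> > 0" using C a0 by (simp add: \<delta>_def)
  moreover have "\<exists>s::complex. 0 \<le> Re s \<and> s ^ n + of_real \<mu> * (\<Sum>k<n. of_real (a k) * s ^ k) = 0"
    if \<mu>: "\<mu> < \<delta>" for \<mu>
  proof -
    define p where "p = monom 1 n + smult \<mu> (\<Sum>k<n. monom (a k) k)"
    have p_coeff: "coeff p k = (if k = n then 1 else if k < n then \<mu> * a k else 0)" for k
      by (auto simp: p_def coeff_sum)
    have p_deg: "degree p = n"
      by (intro antisym degree_le le_degree) (auto simp: p_coeff)
    have p_poly: "poly (map_poly complex_of_real p) s
        = s ^ n + of_real \<mu> * (\<Sum>k<n. of_real (a k) * s ^ k)" for s
      by (simp add: poly_altdef degree_map_poly p_deg coeff_map_poly p_coeff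
            flip: lessThan_Suc_atMost)
         (simp add: sum_distrib_left mult_ac)
    have "\<exists>s. 0 \<le> Re s \<and> poly (map_poly complex_of_real p) s = 0"
    proof (cases "\<mu> > 0")
      case True
      show ?thesis
      proof (rule ccontr)
        assume "\<not> ?thesis"
        then have "\<And>z. poly (map_poly complex_of_real p) z = 0 \<Longrightarrow> Re z \<le> 0"
          by force
        then have "(coeff p 0)\<^sup>2 \<le> ((coeff p (n - 1))\<^sup>2 + 2 * coeff p (n - 2)) ^ n"
          using n by (intro closed_left_half_plane_poly_coeff_bound) (auto simp: p_deg p_coeff)
        then have "(\<mu> * a 0)\<^sup>2 \<le> ((\<mu> * a (n - 1))\<^sup>2 + 2 * (\<mu> * a (n - 2))) ^ n"
          using n by (auto simp: p_coeff split: if_splits)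
        also have "\<dots> \<le> (\<mu> * C) ^ n"
        proof (rule power_mono)
          have "\<mu> < 1 / C" using \<mu> by (simp add: \<delta>_def)
          also have "\<dots> \<le> 1" using C by simp
          finally have "\<mu> \<le> 1" by simp
          then have "\<mu>\<^sup>2 * (a (n - 1))\<^sup>2 \<le> \<mu> * (a (n - 1))\<^sup>2"
            using True by (intro mult_right_mono) (auto simp: power2_eq_square)
          then show "(\<mu> * a (n - 1))\<^sup>2 + 2 * (\<mu> * a (n - 2)) \<le> \<mu> * C"
            using True by (simp add: C_def power_mult_distrib algebra_simps)
          show "0 \<le> (\<mu> * a (n - 1))\<^sup>2 + 2 * (\<mu> * a (n - 2))"
            using True a[of "n - 2"] n by simp
        qed
        \<comment> \<open>the third power beats the \<open>\<mu>\<^sup>2\<close> on the left; here \<open>n \<ge> 3\<close> is used\<close>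
        also have "\<dots> \<le> (\<mu> * C) ^ 3"
          using n True C \<mu> by (intro power_decreasing) (auto simp: \<delta>_def field_simps)
        finally have "\<mu>\<^sup>2 * (a 0)\<^sup>2 \<le> \<mu>\<^sup>2 * (\<mu> * C ^ 3)"
          by (simp add: power_mult_distrib power3_eq_cube power2_eq_square mult_ac)
        then have "(a 0)\<^sup>2 \<le> \<mu> * C ^ 3"
          using True by simp
        moreover have "\<mu> * C ^ 3 < (a 0)\<^sup>2"
          using \<mu> C by (simp add: \<delta>_def field_simps)
        ultimately show False by simp
      qed
    next
      case False
      have "\<exists>x\<ge>0. poly p x = 0"
      proof (cases "\<mu> = 0")
        case True
        then show ?thesis using n by (intro exI[of _ 0]) (simp add: p_def poly_monom)
      next
        case False
        with \<open>\<not> \<mu> > 0\<close> have neg: "poly p 0 < 0"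
          using n a0 by (simp add: poly_0_coeff_0 p_coeff mult_less_0_iff)
        have "lead_coeff p = 1" by (simp add: p_deg p_coeff)
        then obtain x\<^sub>1 where "\<And>x. x \<ge> x\<^sub>1 \<Longrightarrow> poly p x \<ge> 1"
          using poly_pinfty_gt_lc[of p] by auto
        then have "poly p (max x\<^sub>1 1) \<ge> 1"
          by simp
        then have "poly p (max x\<^sub>1 1) > 0"
          by linarith
        from poly_IVT_pos[OF _ neg this] obtain x where "0 < x" "poly p x = 0"
          by (auto simp: less_max_iff_disj)
        then show ?thesis by (intro exI[of _ x]) simp
      qed
      then obtain x where x: "x \<ge> 0" "poly p x = 0" by blast
      have "poly (map_poly complex_of_real p) (of_real x) = of_real (poly p x)"
        by (simp add: poly_altdef degree_map_poly coeff_map_poly)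
      then show ?thesis using x by (intro exI[of _ "of_real x"]) simp
    qed
    then show ?thesis by (simp add: p_poly)
  qed
  ultimately show ?thesis using that by blast
qed

section \<open>The least eigenvalue of a symmetric matrix\<close>

text \<open>The least eigenvalue as the minimum of the Rayleigh quotient.  An \<open>m \<times> m\<close> matrix is a function of
  two indices below \<open>m\<close>, and vectors are functions on the natural numbers whose values at arguments
  \<open>\<ge> m\<close> do not matter, so that \<open>m\<close> can depend on other data.\<close>

lemma symmetric_least_eigenvector:
  fixes M :: "nat \<Rightarrow> nat \<Rightarrow> real"
  assumes m: "m > 0" and sym: "\<And>i j. i < m \<Longrightarrow> j < m \<Longrightarrow> M i j = M j i"
  obtains \<mu> f where "\<exists>i<m. f i \<noteq> 0"
    "\<And>i. i < m \<Longrightarrow> (\<Sum>j<m. M i j * f j) = \<mu> * f i"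
    "\<And>g. \<mu> * (\<Sum>i<m. (g i)\<^sup>2) \<le> (\<Sum>i<m. \<Sum>j<m. g i * M i j * g j)"
proof -
  define Q where "Q = (\<lambda>g. \<Sum>i<m. \<Sum>j<m. g i * M i j * g j)"
  \<comment> \<open>the unit sphere, with vectors extended by \<open>0\<close>, is compact in the product topology\<close>
  define K :: "(nat \<Rightarrow> real) set"
    where "K = Pi\<^sub>E UNIV (\<lambda>i. if i < m then {-1..1} else {0}) \<inter> {f. (\<Sum>i<m. (f i)\<^sup>2) = 1}"
  have cont_coord: "continuous_on A (\<lambda>f. f i :: real)" for A and i :: nat
    by (rule continuous_on_subset[OF continuous_on_product_coordinates]) simp
  have "compactin (product_topology (\<lambda>_. euclidean) UNIV)
      (Pi\<^sub>E UNIV (\<lambda>i::nat. if i < m then {-1..1::real} else {0}))"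
    unfolding compactin_PiE by auto
  then have "compact (Pi\<^sub>E UNIV (\<lambda>i::nat. if i < m then {-1..1::real} else {0}))"
    by (simp add: euclidean_product_topology)
  moreover have "closed {f. (\<Sum>i<m. (f i)\<^sup>2) = (1::real)}"
    by (intro closed_Collect_eq continuous_intros cont_coord)
  ultimately have "compact K"
    unfolding K_def by (rule compact_Int_closed)
  moreover have "(\<lambda>i. if i = 0 then 1 else 0) \<in> K"
    using m by (auto simp: K_def if_distrib[of "\<lambda>x. x ^ 2"] cong: if_cong)
  then have "K \<noteq> {}" by blast
  moreover have "continuous_on K Q"
    unfolding Q_def by (intro continuous_intros cont_coord)
  ultimately obtain f where f: "f \<in> K" and f_min: "\<And>g. g \<in> K \<Longrightarrow> Q f \<le> Q g"
    using continuous_attains_inf[of K Q] by blast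
  define \<mu> where "\<mu> = Q f"
  have f_norm: "(\<Sum>i<m. (f i)\<^sup>2) = 1" using f by (simp add: K_def)
  have Rayleigh: "\<mu> * (\<Sum>i<m. (g i)\<^sup>2) \<le> Q g" for g
  proof (cases "(\<Sum>i<m. (g i)\<^sup>2) = 0")
    case True
    then have "g i = 0" if "i < m" for i
      using that by (simp add: sum_nonneg_eq_0_iff)
    then show ?thesis by (simp add: Q_def)
  next
    case False
    define r where "r = sqrt (\<Sum>i<m. (g i)\<^sup>2)"
    have r2: "r\<^sup>2 = (\<Sum>i<m. (g i)\<^sup>2)" by (simp add: r_def sum_nonneg)
    have r: "r > 0" using False by (simp add: r_def sum_nonneg less_le)
    define h where "h = (\<lambda>i. if i < m then g i / r else 0)"
    have h_norm: "(\<Sum>i<m. (h i)\<^sup>2) = 1"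
      using r by (simp add: h_def power_divide flip: sum_divide_distrib r2)
    have "- 1 \<le> h i \<and> h i \<le> 1" if "i < m" for i
    proof -
      have "(h i)\<^sup>2 \<le> 1"
        using member_le_sum[of i "{..<m}" "\<lambda>i. (h i)\<^sup>2"] that h_norm by simp
      then show ?thesis by (simp add: abs_square_le_1 abs_le_iff)
    qed
    moreover have "h i = 0" if "\<not> i < m" for i
      using that by (simp add: h_def)
    ultimately have "h \<in> K"
      using h_norm by (auto simp: K_def)
    then have "\<mu> \<le> Q h" using f_min by (simp add: \<mu>_def)
    also have "Q h = Q g / r\<^sup>2"
      by (simp add: Q_def h_def sum_divide_distrib power2_eq_square)
    finally show ?thesis using r by (simp add: field_simps flip: r2)
  qed
  have eigen: "(\<Sum>j<m. M i j * f j) = \<mu> * f i" if i: "i < m" for i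
  proof -
    define d where "d = (\<Sum>j<m. M i j * f j) - \<mu> * f i"
    define e where "e = (\<lambda>j. if j = i then 1 else 0 :: real)"
    have e_sum: "(\<Sum>j<m. e j * h j) = h i" for h
      using i sum.delta[of "{..<m}" i h] by (simp add: e_def if_distrib[of "\<lambda>x. x * _"] cong: if_cong)
    \<comment> \<open>the first-order condition at the minimizer \<open>f\<close>: perturb it by \<open>t\<close> times the unit vector \<open>e\<close>\<close>
    have ineq: "0 \<le> t * (2 * d + t * (M i i - \<mu>))" for t
    proof -
      have "(\<Sum>j<m. (f j + t * e j)\<^sup>2) = (\<Sum>j<m. (f j)\<^sup>2 + e j * (2 * t * f j + t\<^sup>2))"
        by (intro sum.cong) (auto simp: e_def power2_eq_square algebra_simps)
      also have "\<dots> = 1 + 2 * t * f i + t\<^sup>2"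
        by (simp add: sum.distrib e_sum f_norm)
      finally have norm: "(\<Sum>j<m. (f j + t * e j)\<^sup>2) = 1 + 2 * t * f i + t\<^sup>2" .
      have expand: "(f k + t * e k) * M k j * (f j + t * e j) = f k * M k j * f j
          + t * (e k * (M k j * f j)) + t * (e j * (f k * M k j)) + t\<^sup>2 * (e k * (e j * M k j))" for k j
        by (simp add: power2_eq_square algebra_simps)
      have "Q (\<lambda>j. f j + t * e j) = Q f + t * (\<Sum>k<m. \<Sum>j<m. e k * (M k j * f j))
          + t * (\<Sum>k<m. \<Sum>j<m. e j * (f k * M k j)) + t\<^sup>2 * (\<Sum>k<m. \<Sum>j<m. e k * (e j * M k j))"
        by (simp only: Q_def expand sum.distrib sum_distrib_left)
      also have "(\<Sum>k<m. \<Sum>j<m. e k * (M k j * f j)) = (\<Sum>j<m. M i j * f j)"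
        by (simp only: e_sum flip: sum_distrib_left)
      also have "(\<Sum>k<m. \<Sum>j<m. e j * (f k * M k j)) = (\<Sum>k<m. f k * M k i)"
        by (simp only: e_sum)
      also have "\<dots> = (\<Sum>j<m. M i j * f j)"
        using i sym by (intro sum.cong) (auto simp: mult.commute)
      also have "(\<Sum>k<m. \<Sum>j<m. e k * (e j * M k j)) = M i i"
        by (simp only: e_sum flip: sum_distrib_left)
      finally have "Q (\<lambda>j. f j + t * e j) = \<mu> + 2 * t * (\<Sum>j<m. M i j * f j) + t\<^sup>2 * M i i"
        by (simp add: \<mu>_def)
      then show ?thesis
        using Rayleigh[of "\<lambda>j. f j + t * e j"] norm
        by (simp add: d_def power2_eq_square algebra_simps)
    qed
    have "d = 0"
    proof (rule ccontr)
      assume d: "d \<noteq> 0"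
      \<comment> \<open>\<open>t = - d / c\<close> with \<open>c > M i i - \<mu>\<close> makes the linear term dominate\<close>
      define c where "c = \<bar>M i i - \<mu>\<bar> + 1"
      have c: "c > 0" "M i i - \<mu> < c" by (auto simp: c_def)
      have "0 \<le> (- d / c) * (2 * d + (- d / c) * (M i i - \<mu>))" by (rule ineq)
      also have "\<dots> = (d\<^sup>2 / c\<^sup>2) * ((M i i - \<mu>) - 2 * c)"
        using c by (simp add: field_simps power2_eq_square)
      also have "\<dots> < 0"
        using c d by (intro mult_pos_neg) auto
      finally show False by simp
    qed
    then show ?thesis by (simp add: d_def)
  qed
  have "\<exists>i<m. f i \<noteq> 0"
  proof (rule ccontr)
    assume "\<not> ?thesis"
    then have "(\<Sum>i<m. (f i)\<^sup>2) = 0" by simp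
    then show False using f_norm by simp
  qed
  then show ?thesis
    using that eigen Rayleigh unfolding Q_def by blast
qed

section \<open>The grounded Laplacian\<close>

lemma grounded_laplacian_dim:
  "dim_row (grounded_laplacian N G w) = N - 1" "dim_col (grounded_laplacian N G w) = N - 1"
  by (simp_all add: grounded_laplacian_def laplacian_def mat_delete_def)

lemma grounded_laplacian_index:
  assumes "i < N - 1" "j < N - 1"
  shows "grounded_laplacian N G w $$ (i, j) =
    (if i = j then \<Sum>k\<in>neighbors G (i + 2). w (i + 2) k
     else if j + 2 \<in> neighbors G (i + 2) then - w (i + 2) (j + 2) else 0)"
  using assms by (auto simp: grounded_laplacian_def laplacian_def mat_delete_def Let_def)

lemma neighbors_subset:
  assumes "undirected_weighted_graph N G w"
  shows "neighbors G i \<subseteq> {1..N} - {i}"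
proof
  fix j assume j: "j \<in> neighbors G i"
  interpret pair_graph G using assms by (simp add: undirected_weighted_graph_def)
  from j show "j \<in> {1..N} - {i}"
    using assms wellformed[of "(i, j)"] no_loops[of "(i, j)"]
    by (auto simp: neighbors_def undirected_weighted_graph_def)
qed

lemma grounded_laplacian_symmetric:
  assumes "undirected_weighted_graph N G w" "i < N - 1" "j < N - 1"
  shows "grounded_laplacian N G w $$ (i, j) = grounded_laplacian N G w $$ (j, i)"
proof -
  interpret pair_graph G using assms by (simp add: undirected_weighted_graph_def)
  have "j + 2 \<in> neighbors G (i + 2) \<longleftrightarrow> i + 2 \<in> neighbors G (j + 2)"
    using arcs_symmetric by (auto simp: neighbors_def)
  moreover have "w (i + 2) (j + 2) = w (j + 2) (i + 2)"
    using assms by (simp add: undirected_weighted_graph_def)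
  ultimately show ?thesis using assms by (auto simp: grounded_laplacian_index)
qed

text \<open>Deleting the leader's column leaves its weight \<open>w\<^sub>i\<^sub>1\<close> uncompensated in the row of node \<open>i\<close>;
  row \<open>i\<close> belongs to node \<open>i + 2\<close>.\<close>

lemma grounded_laplacian_row_sum:
  assumes G: "undirected_weighted_graph N G w" and i: "i < N - 1"
  shows "(\<Sum>j<N - 1. grounded_laplacian N G w $$ (i, j)) = w (i + 2) 1"
proof -
  have w0: "w (i + 2) k = 0" if "k \<in> {1..N}" "k \<notin> neighbors G (i + 2)" for k
    using G that i by (auto simp: undirected_weighted_graph_def neighbors_def)
  have "(\<Sum>k\<in>neighbors G (i + 2). w (i + 2) k) = (\<Sum>k\<in>{1..N} - {i + 2}. w (i + 2) k)"
    using neighbors_subset[OF G] w0 by (intro sum.mono_neutral_left) auto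
  also have "{1..N} - {i + 2} = insert 1 ((\<lambda>j. j + 2) ` ({..<N - 1} - {i}))" (is "?A = ?B")
  proof (intro equalityI subsetI)
    fix k assume "k \<in> ?A"
    then have "k = 1 \<or> (k - 2 \<in> {..<N - 1} - {i} \<and> k = (k - 2) + 2)" by auto
    then show "k \<in> ?B" by blast
  qed (use i in auto)
  also have "(\<Sum>k\<in>?B. w (i + 2) k) = w (i + 2) 1 + (\<Sum>j\<in>{..<N - 1} - {i}. w (i + 2) (j + 2))"
    by (subst sum.insert) (auto simp: sum.reindex[OF inj_onI])
  finally have diag: "grounded_laplacian N G w $$ (i, i)
      = w (i + 2) 1 + (\<Sum>j\<in>{..<N - 1} - {i}. w (i + 2) (j + 2))"
    using i by (simp add: grounded_laplacian_index)
  have "(\<Sum>j\<in>{..<N - 1} - {i}. grounded_laplacian N G w $$ (i, j))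
      = (\<Sum>j\<in>{..<N - 1} - {i}. - w (i + 2) (j + 2))"
    using i w0 by (intro sum.cong) (auto simp: grounded_laplacian_index)
  then show ?thesis
    using i diag by (subst sum.remove[of _ i]) (auto simp: sum_negf)
qed

lemma grounded_laplacian_sum_le:
  assumes G: "undirected_weighted_graph N G w" and N: "N \<ge> 2"
    and card: "card (neighbors G 1) \<le> q"
    and w_max: "\<And>j. (1, j) \<in> parcs G \<Longrightarrow> w 1 j \<le> w_max" "w_max \<ge> 0"
  shows "(\<Sum>i<N - 1. \<Sum>j<N - 1. grounded_laplacian N G w $$ (i, j)) \<le> real q * w_max"
proof -
  have "(\<Sum>i<N - 1. \<Sum>j<N - 1. grounded_laplacian N G w $$ (i, j)) = (\<Sum>i<N - 1. w 1 (i + 2))"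
  proof (rule sum.cong[OF refl])
    fix i assume "i \<in> {..<N - 1}"
    then have i: "i < N - 1" by simp
    have "w (i + 2) 1 = w 1 (i + 2)"
      using G i by (simp add: undirected_weighted_graph_def)
    then show "(\<Sum>j<N - 1. grounded_laplacian N G w $$ (i, j)) = w 1 (i + 2)"
      using grounded_laplacian_row_sum[OF G i] by simp
  qed
  also have "\<dots> = (\<Sum>k\<in>(\<lambda>i. i + 2) ` {..<N - 1}. w 1 k)"
    by (simp add: sum.reindex[OF inj_onI])
  also have "(\<lambda>i. i + 2) ` {..<N - 1} = {1..N} - {1}"
  proof (intro equalityI subsetI)
    fix k assume "k \<in> {1..N} - {1}"
    then have "k - 2 \<in> {..<N - 1} \<and> k = (k - 2) + 2" by auto
    then show "k \<in> (\<lambda>i. i + 2) ` {..<N - 1}" by blast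
  qed auto
  also have "(\<Sum>k\<in>{1..N} - {1}. w 1 k) = (\<Sum>k\<in>neighbors G 1. w 1 k)"
    using neighbors_subset[OF G, of 1] G N
    by (intro sum.mono_neutral_right) (auto simp: undirected_weighted_graph_def neighbors_def)
  also have "\<dots> \<le> real (card (neighbors G 1)) * w_max"
    using w_max by (intro sum_bounded_above) (auto simp: neighbors_def)
  also have "\<dots> \<le> real q * w_max"
    using card w_max by (intro mult_right_mono) auto
  finally show ?thesis .
qed

section \<open>Modal solutions of the closed loop\<close>

lemma sum_blocks:
  fixes f :: "nat \<Rightarrow> nat \<Rightarrow> 'a::comm_monoid_add"
  assumes "m > 0"
  shows "(\<Sum>c<n * m. f (c div m) (c mod m)) = (\<Sum>k<n. \<Sum>j<m. f k j)"
proof -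
  have "(\<Sum>c<n * m. f (c div m) (c mod m)) = (\<Sum>k<n. \<Sum>c=k * m..<k * m + m. f (c div m) (c mod m))"
    by (rule sum.nat_group[symmetric])
  also have "\<dots> = (\<Sum>k<n. \<Sum>j<m. f k j)"
  proof (rule sum.cong[OF refl])
    fix k
    have "(\<Sum>c=0 + k * m..<m + k * m. f (c div m) (c mod m)) = (\<Sum>j=0..<m. f ((j + k * m) div m) ((j + k * m) mod m))"
      by (rule sum.shift_bounds_nat_ivl)
    then show "(\<Sum>c=k * m..<k * m + m. f (c div m) (c mod m)) = (\<Sum>j<m. f k j)"
      by (simp add: add.commute atLeast0LessThan)
  qed
  finally show ?thesis .
qed

text \<open>In the stacked vector, \<open>r div m\<close> is the order of the derivative and \<open>r mod m\<close> the component of the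
  eigenvector.\<close>

lemma closed_loop_modal_solution:
  fixes L :: "real mat" and v :: "nat \<Rightarrow> real" and s :: complex
  assumes dim: "dim_row L = m" and m: "m > 0" and n: "n > 0"
    and eigen: "\<And>i. i < m \<Longrightarrow> (\<Sum>j<m. L $$ (i, j) * v j) = \<mu> * v i"
    and root: "s ^ n + of_real \<mu> * (\<Sum>k<n. of_real (a k) * s ^ k) = 0"
  shows "solves_linear_ode (closed_loop_matrix n a L)
    (\<lambda>t. vec (n * m) (\<lambda>r. Re (s ^ (r div m) * exp (of_real t * s)) * v (r mod m)))"
    (is "solves_linear_ode ?A ?\<xi>")
  unfolding solves_linear_ode_def
proof (intro allI impI conjI)
  have dim_A: "dim_row ?A = n * m" "dim_col ?A = n * m"
    by (simp_all add: closed_loop_matrix_def Let_def dim)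
  fix t :: real
  show "?\<xi> t \<in> carrier_vec (dim_row ?A)" by (simp add: dim_A)
  fix r assume "r < dim_row ?A"
  then have r: "r < n * m" by (simp add: dim_A)
  then have k: "r div m < n" and i: "r mod m < m"
    using m by (auto simp: less_mult_imp_div_less)
  define E where "E = (\<lambda>k. Re (s ^ k * exp (of_real t * s)))"
  have A_row: "(?A *\<^sub>v ?\<xi> t) $ r = (\<Sum>c<n * m. ?A $$ (r, c) * (E (c div m) * v (c mod m)))"
    using r by (simp add: scalar_prod_def dim_A atLeast0LessThan E_def)
  \<comment> \<open>the matrix shifts the derivative order by one: the last block row by the root equation and the
    eigenvector property, the others by the identity blocks\<close>
  have A_xi: "(?A *\<^sub>v ?\<xi> t) $ r = E (Suc (r div m)) * v (r mod m)"
  proof (cases "r div m = n - 1")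
    case True
    have "(?A *\<^sub>v ?\<xi> t) $ r
        = (\<Sum>c<n * m. - a (c div m) * L $$ (r mod m, c mod m) * (E (c div m) * v (c mod m)))"
      unfolding A_row using r True
      by (intro sum.cong) (auto simp: closed_loop_matrix_def Let_def dim)
    also have "\<dots> = (\<Sum>k<n. \<Sum>j<m. - a k * L $$ (r mod m, j) * (E k * v j))"
      using m by (rule sum_blocks)
    also have "\<dots> = (\<Sum>k<n. - a k * E k * (\<Sum>j<m. L $$ (r mod m, j) * v j))"
      by (simp add: sum_distrib_left mult_ac)
    also have "\<dots> = - (\<mu> * (\<Sum>k<n. a k * E k)) * v (r mod m)"
      unfolding eigen[OF i] by (simp add: sum_distrib_left sum_distrib_right sum_negf mult_ac)
    also have "- (\<mu> * (\<Sum>k<n. a k * E k)) = E n"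
    proof -
      have "s ^ n = - of_real \<mu> * (\<Sum>k<n. of_real (a k) * s ^ k)"
        using root by (simp add: eq_neg_iff_add_eq_0)
      then have "s ^ n * exp (of_real t * s)
          = of_real (- \<mu>) * (\<Sum>k<n. of_real (a k) * (s ^ k * exp (of_real t * s)))"
        by (simp add: sum_distrib_left sum_distrib_right mult_ac)
      then have "E n = Re (of_real (- \<mu>) * (\<Sum>k<n. of_real (a k) * (s ^ k * exp (of_real t * s))))"
        by (simp only: E_def)
      also have "\<dots> = - \<mu> * (\<Sum>k<n. a k * E k)"
        by (simp add: E_def)
      finally show ?thesis by simp
    qed
    finally show ?thesis using True n by simp
  next
    case False
    have "(?A *\<^sub>v ?\<xi> t) $ r
        = (\<Sum>c<n * m. (if c div m = r div m + 1 \<and> c mod m = r mod m then 1 else 0)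
            * (E (c div m) * v (c mod m)))"
      unfolding A_row using r False m
      by (intro sum.cong) (auto simp: closed_loop_matrix_def Let_def dim)
    also have "\<dots> = (\<Sum>k<n. \<Sum>j<m. (if k = r div m + 1 \<and> j = r mod m then 1 else 0) * (E k * v j))"
      using m by (rule sum_blocks)
    also have "\<dots> = (\<Sum>k<n. if k = r div m + 1 then
        \<Sum>j<m. if j = r mod m then E k * v j else 0 else 0)"
      by (intro sum.cong) (auto simp: if_distrib[of "\<lambda>x. x * _"] cong: if_cong)
    also have "\<dots> = E (Suc (r div m)) * v (r mod m)"
      using False k i by (simp cong: if_cong)
    finally show ?thesis .
  qed
  have E_Suc: "Re (s ^ k * (s * exp (of_real t * s))) = E (Suc k)" for k
    by (simp only: E_def power_Suc mult_ac)
  have "((\<lambda>t. s ^ (r div m) * exp (of_real t * s)) has_vector_derivative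
      s ^ (r div m) * (s * exp (of_real t * s))) (at t within {0..})"
    by (rule has_vector_derivative_real_field[where f = "\<lambda>z. s ^ (r div m) * exp (z * s)"])
      (auto intro!: derivative_eq_intros)
  then have "((\<lambda>t. Re (s ^ (r div m) * exp (of_real t * s))) has_vector_derivative
      E (Suc (r div m))) (at t within {0..})"
    unfolding E_Suc[symmetric] by (rule bounded_linear.has_vector_derivative[OF bounded_linear_Re])
  then have "((\<lambda>t. Re (s ^ (r div m) * exp (of_real t * s)) * v (r mod m)) has_real_derivative
      E (Suc (r div m)) * v (r mod m)) (at t within {0..})"
    unfolding has_real_derivative_iff_has_vector_derivative[symmetric] by (rule DERIV_cmult_right)
  then show "((\<lambda>t. ?\<xi> t $ r) has_real_derivative (?A *\<^sub>v ?\<xi> t) $ r) (at t within {0..})"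
    unfolding A_xi using r by simp
qed

lemma Re_exp_not_tendsto_0:
  assumes "0 \<le> Re s"
  shows "\<not> ((\<lambda>t. Re (exp (of_real t * s))) \<longlongrightarrow> 0) at_top"
proof
  assume lim: "((\<lambda>t. Re (exp (of_real t * s))) \<longlongrightarrow> 0) at_top"
  \<comment> \<open>at multiples of the period of \<open>cos (t Im s)\<close> the value is \<open>e\<^bsup>t Re s\<^esup> \<ge> 1\<close>; any period will do if
    \<open>Im s = 0\<close>\<close>
  define T where "T = (if Im s = 0 then 1 else 2 * pi / \<bar>Im s\<bar>)"
  have T: "T > 0" by (simp add: T_def)
  have T_Im: "cos (real l * T * Im s) = 1" for l
  proof (cases "Im s = 0")
    case False
    then have "\<bar>real l * T * Im s\<bar> = 2 * pi * real l"
      by (simp add: T_def abs_mult)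
    then show ?thesis
      using cos_2npi[of l] by (metis cos_abs_real mult.assoc mult.commute)
  qed simp
  have "filterlim (\<lambda>l. real l * T) at_top sequentially"
    using T by (intro filterlim_at_top_mult_tendsto_pos[OF tendsto_const] filterlim_real_sequentially)
  then have "(\<lambda>l. Re (exp (of_real (real l * T) * s))) \<longlonglongrightarrow> 0"
    by (rule filterlim_compose[OF lim])
  moreover have "1 \<le> Re (exp (of_real (real l * T) * s))" for l
    using T_Im[of l] T assms by (simp add: Re_exp mult.assoc)
  ultimately have "(1::real) \<le> 0"
    by (intro LIMSEQ_le_const) auto
  then show False by simp
qed

lemma unstable_mode_no_consensus:
  fixes s :: complex
  assumes n: "n > 0" and N: "N \<ge> 2"
    and eigen: "\<And>i. i < N - 1 \<Longrightarrow>
      (\<Sum>j<N - 1. grounded_laplacian N G w $$ (i, j) * v j) = \<mu> * v i"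
    and nonzero: "i\<^sub>0 < N - 1" "v i\<^sub>0 \<noteq> 0"
    and root: "s ^ n + of_real \<mu> * (\<Sum>k<n. of_real (a k) * s ^ k) = 0" "0 \<le> Re s"
  shows "\<not> reaches_consensus n a N G w"
proof
  assume consensus: "reaches_consensus n a N G w"
  define m where "m = N - 1"
  have m: "m > 0" "i\<^sub>0 < m" using N nonzero by (simp_all add: m_def)
  define \<xi> where "\<xi> = (\<lambda>t. vec (n * m)
    (\<lambda>r. Re (s ^ (r div m) * exp (complex_of_real t * s)) * v (r mod m)))"
  have "solves_linear_ode (closed_loop_matrix n a (grounded_laplacian N G w)) \<xi>"
    unfolding \<xi>_def using m n eigen root
    by (intro closed_loop_modal_solution[where \<mu> = \<mu>]) (auto simp: grounded_laplacian_dim m_def)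
  moreover have "\<xi> 0 \<in> carrier_vec (n * (N - 1))"
    by (simp add: \<xi>_def m_def)
  moreover have "i\<^sub>0 + 2 \<in> {1..N}" "1 \<in> {1..N}"
    using N nonzero by auto
  ultimately have "((\<lambda>t. node_state N \<xi> (i\<^sub>0 + 2) 0 t - node_state N \<xi> 1 0 t) \<longlongrightarrow> 0) at_top"
    using consensus n unfolding reaches_consensus_def by blast
  moreover have "node_state N \<xi> (i\<^sub>0 + 2) 0 t - node_state N \<xi> 1 0 t
      = Re (exp (complex_of_real t * s)) * v i\<^sub>0" for t
  proof -
    have "i\<^sub>0 < n * m"
      using m n by (metis less_le_trans mult_le_mono1 nat_mult_1 Suc_leI One_nat_def)
    then show ?thesis using m by (simp add: node_state_def \<xi>_def)
  qed
  ultimately have "((\<lambda>t. Re (exp (complex_of_real t * s)) * v i\<^sub>0) \<longlongrightarrow> 0) at_top"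
    by simp
  from tendsto_mult_right[OF this, of "inverse (v i\<^sub>0)"]
  have "((\<lambda>t. Re (exp (complex_of_real t * s))) \<longlongrightarrow> 0) at_top"
    using nonzero by (simp add: mult.assoc)
  then show False using Re_exp_not_tendsto_0 root by blast
qed

section \<open>Inadmissibility\<close>

theorem theorem5:
  fixes n q :: nat
    and w_max a_max :: real
    and a :: "nat \<Rightarrow> real"
    and S :: "nat set"
    and G :: "nat \<Rightarrow> nat pair_pre_digraph"
    and w :: "nat \<Rightarrow> nat \<Rightarrow> nat \<Rightarrow> real"
  assumes "n \<ge> 3"
    and "q > 0" and "w_max > 0" and "a_max > 0"
    and "infinite S" and "\<forall>N \<in> S. N \<ge> 2"
    and "\<forall>N \<in> S. undirected_weighted_graph N (G N) (w N)"
    and "\<forall>N \<in> S. \<forall>i \<in> {1..N}. reachable (with_proj (G N)) 1 i"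
    and "\<forall>N \<in> S. \<forall>i \<in> {1..N}. card (neighbors (G N) i) \<le> q"
    and "\<forall>N \<in> S. \<forall>(i, j) \<in> parcs (G N). w N i j \<le> w_max"
    and "\<forall>k < n. 0 \<le> a k \<and> a k \<le> a_max"
  shows "\<not> admissible n a S G w"
proof -
  obtain \<delta> :: real where \<delta>: "\<delta> > 0" and unstable:
    "\<And>\<mu>. \<mu> < \<delta> \<Longrightarrow> \<exists>s::complex. 0 \<le> Re s \<and> s ^ n + of_real \<mu> * (\<Sum>k<n. of_real (a k) * s ^ k) = 0"
    using small_gain_unstable_root[of n a] assms(1,11) by blast
  obtain b where b: "real q * w_max / \<delta> < real b"
    using reals_Archimedean2 by blast
  obtain N where N: "N \<in> S" "N > b + 1"
    using \<open>infinite S\<close> by (auto simp: infinite_nat_iff_unbounded)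
  let ?L = "grounded_laplacian N (G N) (w N)"
  have graph: "undirected_weighted_graph N (G N) (w N)" and N2: "N \<ge> 2"
    using assms(6,7) N by auto
  obtain \<mu> f where f: "\<exists>i<N - 1. f i \<noteq> 0"
    and eigen: "\<And>i. i < N - 1 \<Longrightarrow> (\<Sum>j<N - 1. ?L $$ (i, j) * f j) = \<mu> * f i"
    and Rayleigh: "\<And>g. \<mu> * (\<Sum>i<N - 1. (g i)\<^sup>2) \<le> (\<Sum>i<N - 1. \<Sum>j<N - 1. g i * ?L $$ (i, j) * g j)"
  proof (rule symmetric_least_eigenvector[of "N - 1" "\<lambda>i j. ?L $$ (i, j)"])
    show "0 < N - 1" using N2 by simp
  qed (use grounded_laplacian_symmetric[OF graph] in blast)+
  \<comment> \<open>the all-ones test vector\<close>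
  have "\<mu> * real (N - 1) \<le> (\<Sum>i<N - 1. \<Sum>j<N - 1. ?L $$ (i, j))"
    using Rayleigh[of "\<lambda>_. 1"] by simp
  also have "\<dots> \<le> real q * w_max"
    using assms(3,9,10) N N2 by (intro grounded_laplacian_sum_le[OF graph]) auto
  also have "\<dots> < \<delta> * real b"
    using b \<delta> by (simp add: field_simps)
  also have "\<dots> \<le> \<delta> * real (N - 1)"
    using N \<delta> by simp
  finally have "\<mu> < \<delta>"
    using N2 by simp
  then obtain s :: complex where
    "0 \<le> Re s" "s ^ n + of_real \<mu> * (\<Sum>k<n. of_real (a k) * s ^ k) = 0"
    using unstable by blast
  then have "\<not> reaches_consensus n a N (G N) (w N)"
    using f eigen N2 assms(1) unstable_mode_no_consensus[of n N "G N" "w N" f \<mu> _ s a] by auto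
  then show ?thesis
    using N by (auto simp: admissible_def)
qed

end
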